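(* If $S\in\mathsf{GL}_n(\mathbb{C})$, then $\mathcal{C}(S)$ is a polyhedral cone and $\mathcal{P}(S)$ is a polytope.
   Context: For $x\in\mathbb{C}^n$, $D_x$ is the diagonal matrix whose $(i,i)$-entry is $x_i$; $e$ is the all-ones vector. For a complex matrix $A$, $A\geqslant 0$ means that all entries of $A$ are real and nonnegative. For $S\in\mathsf{GL}_n(\mathbb{C})$ (invertible complex $n\times n$ matrices) and $x\in\mathbb{C}^n$, put $M_x:=SD_xS^{-1}$. The spectracone of $S$ is $\mathcal{C}(S):=\{x\in\mathbb{C}^n\mid M_x\geqslant 0\}$ and the spectratope of $S$ is $\mathcal{P}(S):=\{x\in\mathcal{C}(S)\mid M_xe=e\}$. With $\langle x,y\rangle=y^\ast x$, for $0\neq a\in\mathbb{C}^n$ and $b\in\mathbb{R}$ let $\mathsf{H}(a,b):=\{x\in\mathbb{C}^n\mid \Re\langle x,a\rangle\geqslant b\}$ (a closed half-space). A polyhedron is a finite intersection of sets $\mathsf{H}(a_k,b_k)$; a polytope is a bounded polyhedron; a polyhedral cone is a finite intersection of half-spaces of the form $\mathsf{H}(a_k,0)$. *)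

theory Defs
  imports "HOL-Analysis.Analysis"
begin

definition diag_mat :: "complex ^ 'n \<Rightarrow> complex ^ 'n ^ 'n" where
  "diag_mat x = (\<chi> i j. if i = j then x $ i else 0)"

definition nonneg_mat :: "complex ^ 'n ^ 'm \<Rightarrow> bool" where
  "nonneg_mat A \<longleftrightarrow> (\<forall>i j. A $ i $ j \<in> \<real> \<and> Re (A $ i $ j) \<ge> 0)"

definition spectral_mat :: "complex ^ 'n ^ 'n \<Rightarrow> complex ^ 'n \<Rightarrow> complex ^ 'n ^ 'n" where
  "spectral_mat S x = S ** diag_mat x ** matrix_inv S"

definition spectracone :: "complex ^ 'n ^ 'n \<Rightarrow> (complex ^ 'n) set" where
  "spectracone S = {x. nonneg_mat (spectral_mat S x)}"

definition spectratope :: "complex ^ 'n ^ 'n \<Rightarrow> (complex ^ 'n) set" where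
  "spectratope S = {x \<in> spectracone S. spectral_mat S x *v vec 1 = vec 1}"

text \<open>The Hermitian product \<open>y\<^sup>* x\<close>: linear in the first argument, conjugate-linear in the second.\<close>

definition hermitian_prod :: "complex ^ 'n \<Rightarrow> complex ^ 'n \<Rightarrow> complex" where
  "hermitian_prod x y = (\<Sum>i\<in>UNIV. cnj (y $ i) * x $ i)"

definition half_space :: "complex ^ 'n \<Rightarrow> real \<Rightarrow> (complex ^ 'n) set" where
  "half_space a b = {x. Re (hermitian_prod x a) \<ge> b}"

text \<open>As for the library's \<^const>\<open>polyhedron\<close>, the empty intersection (the whole space) is allowed.\<close>

definition complex_polyhedron :: "(complex ^ 'n) set \<Rightarrow> bool" where
  "complex_polyhedron P \<longleftrightarrow>
     (\<exists>K. finite K \<and> (\<forall>(a, b) \<in> K. a \<noteq> 0) \<and> P = (\<Inter>(a, b) \<in> K. half_space a b))"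

definition complex_polytope :: "(complex ^ 'n) set \<Rightarrow> bool" where
  "complex_polytope P \<longleftrightarrow> complex_polyhedron P \<and> bounded P"

definition polyhedral_cone :: "(complex ^ 'n) set \<Rightarrow> bool" where
  "polyhedral_cone C \<longleftrightarrow>
     (\<exists>K. finite K \<and> (\<forall>a \<in> K. a \<noteq> 0) \<and> C = (\<Inter>a \<in> K. half_space a 0))"

text \<open>The real part of the Hermitian product is the library's real inner product on
  \<^typ>\<open>complex ^ 'n\<close>, so these notions of polyhedron and polytope agree with the library's.\<close>

lemma Re_hermitian_prod: "Re (hermitian_prod x a) = a \<bullet> x"
  by (simp add: hermitian_prod_def inner_vec_def inner_complex_def)

lemma half_space_eq_inner: "half_space a b = {x. a \<bullet> x \<ge> b}"
  by (simp add: half_space_def Re_hermitian_prod)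

lemma complex_polyhedron_iff_polyhedron: "complex_polyhedron P \<longleftrightarrow> polyhedron P"
proof
  assume "complex_polyhedron P"
  then obtain K where K: "finite K" "\<forall>(a, b) \<in> K. a \<noteq> 0" "P = (\<Inter>(a, b) \<in> K. half_space a b)"
    unfolding complex_polyhedron_def by blast
  have "polyhedron (half_space a b)" for a b
    unfolding half_space_eq_inner by (rule polyhedron_halfspace_ge)
  then show "polyhedron P"
    unfolding K(3) by (intro polyhedron_Inter) (use K(1) in auto)
next
  assume "polyhedron P"
  then obtain F where F: "finite F" "P = \<Inter>F" "\<forall>h\<in>F. \<exists>a b. a \<noteq> 0 \<and> h = {x. a \<bullet> x \<le> b}"
    unfolding polyhedron_def by blast
  have "\<exists>p. fst p \<noteq> 0 \<and> h = half_space (fst p) (snd p)" if "h \<in> F" for h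
  proof -
    from F(3) that obtain a b where "a \<noteq> 0" "h = {x. a \<bullet> x \<le> b}" by blast
    then show ?thesis
      by (intro exI[of _ "(- a, - b)"]) (simp add: half_space_eq_inner)
  qed
  then obtain p where p: "\<And>h. h \<in> F \<Longrightarrow> fst (p h) \<noteq> 0 \<and> h = half_space (fst (p h)) (snd (p h))"
    by metis
  have "(\<Inter>(a, b) \<in> p ` F. half_space a b) = (\<Inter>h \<in> F. half_space (fst (p h)) (snd (p h)))"
    by (simp add: case_prod_beta)
  also have "\<dots> = \<Inter>F"
    using p by auto
  finally have "P = (\<Inter>(a, b) \<in> p ` F. half_space a b)"
    using F(2) by simp
  moreover have "\<forall>(a, b) \<in> p ` F. a \<noteq> 0"
    using p by (auto simp: case_prod_beta)
  ultimately show "complex_polyhedron P"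
    unfolding complex_polyhedron_def using F(1) by blast
qed

lemma complex_polytope_iff_polytope: "complex_polytope P \<longleftrightarrow> polytope P"
  by (simp add: complex_polytope_def complex_polyhedron_iff_polyhedron
      polytope_eq_bounded_polyhedron)

end

theory Submission
  imports Defs
begin

text \<open>
  The map sending \<open>x\<close> to \<^term>\<open>spectral_mat S x\<close> is linear, and a complex number \<open>z\<close> is real and
  nonnegative exactly if the real parts of \<open>z\<close>, \<open>\<i> z\<close> and \<open>- \<i> z\<close> are nonnegative. So
  membership in the spectracone is a finite system of homogeneous real-linear inequalities, one
  triple for each matrix entry, and Riesz representation turns each of them into a half-space
  through the origin. The condition on the row sums adds finitely many real-linear
  equations, so the spectratope is a polyhedron.

  It is bounded because the matrix of a point of the spectratope is row stochastic, hence has its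
  entries in the unit interval, and because the point is recovered linearly from its matrix:
  it is the diagonal of the matrix conjugated back by \<open>S\<close>.
\<close>

lemma spectral_mat_nth:
  "spectral_mat S x $ i $ j = (\<Sum>k\<in>UNIV. S $ i $ k * x $ k * matrix_inv S $ k $ j)"
  unfolding spectral_mat_def matrix_matrix_mult_def diag_mat_def
  by (simp add: if_distrib[of "\<lambda>t. _ * t"] cong: if_cong)

lemma linear_spectral_mat: "linear (spectral_mat S)"
  by (rule linearI)
    (simp_all add: vec_eq_iff spectral_mat_nth algebra_simps sum.distrib scaleR_sum_right)

lemma spectracone_eq_linear_inequalities:
  "spectracone S =
     {x. \<forall>(i, j, c) \<in> UNIV \<times> UNIV \<times> {1, \<i>, - \<i>}. 0 \<le> Re (c * spectral_mat S x $ i $ j)}"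
proof -
  have "z \<in> \<real> \<and> 0 \<le> Re z \<longleftrightarrow> (\<forall>c\<in>{1, \<i>, - \<i>}. 0 \<le> Re (c * z))" for z
    by (auto simp: complex_is_Real_iff)
  then show ?thesis
    unfolding spectracone_def nonneg_mat_def by (simp add: Ball_def)
qed

text \<open>A functional that vanishes identically defines no half-space, but it imposes no condition either,
  so its representing vector can be dropped.\<close>

lemma polyhedral_cone_linear_inequalities:
  fixes f :: "'i \<Rightarrow> complex ^ 'n \<Rightarrow> real"
  assumes "finite I" and lin: "\<And>i. i \<in> I \<Longrightarrow> linear (f i)"
  shows "polyhedral_cone {x. \<forall>i\<in>I. 0 \<le> f i x}"
proof -
  define a where "a i = adjoint (f i) 1" for i
  have a: "f i x = a i \<bullet> x" if "i \<in> I" for i x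
    using adjoint_works[OF lin[OF that], of x 1] by (simp add: a_def inner_commute)
  have "{x. \<forall>i\<in>I. 0 \<le> f i x} = (\<Inter>v \<in> a ` I - {0}. half_space v 0)"
    by (auto simp: a half_space_eq_inner)
  then show ?thesis
    unfolding polyhedral_cone_def using \<open>finite I\<close> by (intro exI[of _ "a ` I - {0}"]) simp
qed

lemma polyhedral_cone_imp_polyhedron:
  assumes "polyhedral_cone C"
  shows "polyhedron C"
proof -
  obtain K where "finite K" and C: "C = (\<Inter>a\<in>K. half_space a 0)"
    using assms unfolding polyhedral_cone_def by blast
  then show ?thesis
    unfolding C half_space_eq_inner by (intro polyhedron_Inter) (auto simp: polyhedron_halfspace_ge)
qed

lemma polyhedral_cone_spectracone: "polyhedral_cone (spectracone S)"
proof -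
  have "linear (\<lambda>x. Re (c * spectral_mat S x $ i $ j))" for c i j
    by (rule linearI)
      (simp_all add: linear_add[OF linear_spectral_mat] linear_cmul[OF linear_spectral_mat]
        algebra_simps)
  then show ?thesis
    unfolding spectracone_eq_linear_inequalities case_prod_unfold
    by (intro polyhedral_cone_linear_inequalities) auto
qed

lemma polyhedron_linear_equation:
  fixes f :: "'a::euclidean_space \<Rightarrow> real"
  assumes "linear f"
  shows "polyhedron {x. f x = b}"
proof -
  have "f x = adjoint f 1 \<bullet> x" for x
    using adjoint_works[OF assms, of x 1] by (simp add: inner_commute)
  then show ?thesis
    by (simp add: polyhedron_hyperplane)
qed

lemma polyhedron_spectratope: "polyhedron (spectratope S)"
proof -
  have lin: "linear (\<lambda>x. Re ((spectral_mat S x *v vec 1) $ i))"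
    "linear (\<lambda>x. Im ((spectral_mat S x *v vec 1) $ i))" for i
    by (rule linearI; simp add: linear_add[OF linear_spectral_mat] linear_cmul[OF linear_spectral_mat]
        matrix_vector_mult_def sum.distrib sum_distrib_left)+
  have "spectratope S = spectracone S \<inter>
      (\<Inter>i. {x. Re ((spectral_mat S x *v vec 1) $ i) = 1} \<inter>
           {x. Im ((spectral_mat S x *v vec 1) $ i) = 0})"
    by (auto simp: spectratope_def vec_eq_iff complex_eq_iff)
  moreover have "polyhedron \<dots>"
    using polyhedral_cone_imp_polyhedron[OF polyhedral_cone_spectracone]
    by (intro polyhedron_Int polyhedron_Inter)
      (auto intro!: polyhedron_Int polyhedron_linear_equation lin simp del: vec_1)
  ultimately show ?thesis by simp
qed

lemma cmod_stochastic_entry_le_1: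
  assumes "nonneg_mat A" and "A *v vec 1 = vec 1"
  shows "cmod (A $ i $ j) \<le> 1"
proof -
  have real: "A $ i $ k \<in> \<real>" and nonneg: "0 \<le> Re (A $ i $ k)" for k
    using assms(1) by (auto simp: nonneg_mat_def)
  have "(\<Sum>k\<in>UNIV. A $ i $ k) = 1"
    using assms(2) by (simp add: vec_eq_iff matrix_vector_mult_def)
  then have "(\<Sum>k\<in>UNIV. Re (A $ i $ k)) = 1"
    by (metis Re_sum one_complex.sel(1))
  moreover have "Re (A $ i $ j) \<le> (\<Sum>k\<in>UNIV. Re (A $ i $ k))"
    by (rule member_le_sum) (auto simp: nonneg)
  moreover have "cmod (A $ i $ j) = Re (A $ i $ j)"
    using real[of j] nonneg[of j] by (simp add: norm_complex_def complex_is_Real_iff)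
  ultimately show ?thesis by simp
qed

lemma matrix_inv_mult_left:
  assumes "invertible A"
  shows "matrix_inv A ** A = mat 1"
  using someI_ex[OF assms[unfolded invertible_def]] by (simp add: matrix_inv_def)

text \<open>This inverts the linear map from \<open>x\<close> to its matrix, by a formula whose coefficients depend on
  \<open>S\<close> only; a bound on the entries of the matrix therefore carries over to \<open>x\<close>.\<close>

lemma nth_eq_conjugated_spectral_mat:
  assumes "invertible S"
  shows "x $ k = (matrix_inv S ** spectral_mat S x ** S) $ k $ k"
proof -
  have "matrix_inv S ** spectral_mat S x ** S
      = (matrix_inv S ** S) ** diag_mat x ** (matrix_inv S ** S)"
    by (simp add: spectral_mat_def matrix_mul_assoc)
  then show ?thesis
    by (simp add: matrix_inv_mult_left[OF assms] diag_mat_def)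
qed

lemma bounded_spectratope:
  assumes "invertible S"
  shows "bounded (spectratope S)"
proof -
  define T where "T = matrix_inv S"
  \<comment> \<open>\<open>B k\<close> is the triangle-inequality bound for the \<open>k\<close>-th diagonal entry of \<open>T ** M ** S\<close>,
    over all \<open>M\<close> with entries in the unit disc.\<close>
  define B where "B k = (\<Sum>j\<in>UNIV. \<Sum>i\<in>UNIV. cmod (T $ k $ i) * cmod (S $ j $ k))" for k
  have "norm x \<le> (\<Sum>k\<in>UNIV. B k)" if "x \<in> spectratope S" for x
  proof -
    define M where "M = spectral_mat S x"
    have M: "cmod (M $ i $ j) \<le> 1" for i j
      using that cmod_stochastic_entry_le_1
      by (auto simp: M_def spectratope_def spectracone_def)
    have "cmod (x $ k) \<le> B k" for k
    proof -
      have "x $ k = (\<Sum>j\<in>UNIV. \<Sum>i\<in>UNIV. T $ k $ i * M $ i $ j * S $ j $ k)"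
        unfolding nth_eq_conjugated_spectral_mat[OF assms, of x k]
        by (simp add: T_def M_def matrix_matrix_mult_def sum_distrib_right)
      also have "cmod \<dots> \<le> B k"
        unfolding B_def
      proof (intro sum_norm_le)
        fix i j
        have "cmod (T $ k $ i) * cmod (M $ i $ j) \<le> cmod (T $ k $ i)"
          using M by (simp add: mult_left_le)
        then show "cmod (T $ k $ i * M $ i $ j * S $ j $ k) \<le> cmod (T $ k $ i) * cmod (S $ j $ k)"
          by (simp add: norm_mult mult_right_mono)
      qed
      finally show ?thesis .
    qed
    then have "(\<Sum>k\<in>UNIV. cmod (x $ k)) \<le> (\<Sum>k\<in>UNIV. B k)"
      by (intro sum_mono)
    then show ?thesis
      using L2_set_le_sum[of UNIV "\<lambda>k. cmod (x $ k)"] by (simp add: norm_vec_def)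
  qed
  then show ?thesis
    unfolding bounded_iff by blast
qed

theorem theorem4p6:
  fixes S :: "complex ^ 'n ^ 'n"
  assumes "invertible S"
  shows "polyhedral_cone (spectracone S) \<and> complex_polytope (spectratope S)"
  using polyhedral_cone_spectracone[of S] polyhedron_spectratope[of S] bounded_spectratope[OF assms]
  by (simp add: complex_polytope_def complex_polyhedron_iff_polyhedron)

end
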